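(* Let $H$ be a graph. The class of $H$-free bipartite graphs is ivc-identical if and only if $H$ is (isomorphic to) an induced subgraph of $K_{1,3}^+$ or of $2P_1+P_3$.
   Context: Graphs are finite, simple and undirected. A graph is $H$-free if it has no induced subgraph isomorphic to $H$. $G+H$ is the disjoint union and $rG$ is the disjoint union of $r$ copies of $G$. $P_n$ is the path on $n$ vertices. $K_{1,3}$ is the star with $3$ leaves, and $K_{1,3}^+$ is the graph obtained from $K_{1,3}$ by subdividing one edge once. A vertex cover of $G$ is a set $S\subseteq V(G)$ such that $G-S$ has no edges. A graph has an independent vertex cover (a vertex cover that is an independent set) if and only if it is bipartite. For a bipartite graph $G$, $\mathrm{vc}(G)$ is the minimum size of a vertex cover and $\mathrm{ivc}(G)$ is the minimum size of an independent vertex cover. A class $\mathcal X$ of bipartite graphs is ivc-identical if $\mathrm{ivc}(G)=\mathrm{vc}(G)$ for every $G\in\mathcal X$. *)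

theory Defs
  imports "Graph_Theory.Graph_Theory" "HOL-Library.Infinite_Typeclass"
begin

text \<open>
  A finite simple undirected graph is a \<^locale>\<open>pair_graph\<close>: a finite, loop-free, symmetric
  digraph whose arcs are pairs of vertices, so that each undirected edge is represented by its two
  orientations. The graph without vertices is allowed.
\<close>

definition embeds_induced :: "'a pair_pre_digraph \<Rightarrow> 'b pair_pre_digraph \<Rightarrow> bool" where
  "embeds_induced H G \<longleftrightarrow>
     (\<exists>F :: 'b pair_pre_digraph.
        induced_subgraph (with_proj F) (with_proj G) \<and> digraph_iso (with_proj F) (with_proj H))"

definition independent_set :: "'a pair_pre_digraph \<Rightarrow> 'a set \<Rightarrow> bool" where
  "independent_set G S \<longleftrightarrow> S \<subseteq> pverts G \<and> arcs (with_proj G \<restriction> S) = {}"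

definition vertex_cover :: "'a pair_pre_digraph \<Rightarrow> 'a set \<Rightarrow> bool" where
  "vertex_cover G S \<longleftrightarrow> S \<subseteq> pverts G \<and> arcs (with_proj G \<restriction> (pverts G - S)) = {}"

definition bipartite :: "'a pair_pre_digraph \<Rightarrow> bool" where
  "bipartite G \<longleftrightarrow>
     (\<exists>A B. A \<union> B = pverts G \<and> A \<inter> B = {} \<and> independent_set G A \<and> independent_set G B)"

lemma bipartite_iff_independent_vertex_cover:
  "bipartite G \<longleftrightarrow> (\<exists>S. vertex_cover G S \<and> independent_set G S)"
proof
  assume "bipartite G"
  then obtain A B where AB: "A \<union> B = pverts G" "A \<inter> B = {}"
    "independent_set G A" "independent_set G B"
    unfolding bipartite_def by blast
  have "pverts G - A = B" using AB(1,2) by blast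
  with AB have "vertex_cover G A"
    unfolding vertex_cover_def independent_set_def by metis
  with AB(3) show "\<exists>S. vertex_cover G S \<and> independent_set G S" by metis
next
  assume "\<exists>S. vertex_cover G S \<and> independent_set G S"
  then obtain S where S: "vertex_cover G S" "independent_set G S" by metis
  then have "S \<subseteq> pverts G" "independent_set G (pverts G - S)"
    unfolding vertex_cover_def independent_set_def by (metis, metis Diff_subset)
  moreover from this(1) have "S \<union> (pverts G - S) = pverts G" "S \<inter> (pverts G - S) = {}"
    by (simp_all add: Un_absorb1)
  ultimately show "bipartite G"
    unfolding bipartite_def using S(2) by metis
qed

definition vc :: "'a pair_pre_digraph \<Rightarrow> nat" where
  "vc G = (LEAST k. \<exists>S. vertex_cover G S \<and> card S = k)"

text \<open>Meaningful for bipartite graphs only: otherwise no independent vertex cover exists.\<close>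

definition ivc :: "'a pair_pre_digraph \<Rightarrow> nat" where
  "ivc G = (LEAST k. \<exists>S. vertex_cover G S \<and> independent_set G S \<and> card S = k)"

definition ivc_identical :: "'a pair_pre_digraph set \<Rightarrow> bool" where
  "ivc_identical X \<longleftrightarrow> (\<forall>G\<in>X. ivc G = vc G)"

text \<open>
  The vertices of the members are taken from the type \<^typ>\<open>'b\<close>. If \<^typ>\<open>'b\<close> is infinite, every
  finite graph has an isomorphic copy there.
\<close>

definition free_bipartite_graphs :: "'a pair_pre_digraph \<Rightarrow> 'b pair_pre_digraph set" where
  "free_bipartite_graphs H = {G. pair_graph G \<and> bipartite G \<and> \<not> embeds_induced H G}"

definition path_graph :: "nat \<Rightarrow> nat pair_pre_digraph" where
  "path_graph n =
     \<lparr> pverts = {..<n}, parcs = {(i, j). i < n \<and> j < n \<and> (j = Suc i \<or> i = Suc j)} \<rparr>"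

text \<open>The centre is \<open>0\<close> and the leaves are \<open>1, \<dots>, n\<close>.\<close>

definition star_graph :: "nat \<Rightarrow> nat pair_pre_digraph" where
  "star_graph n = \<lparr> pverts = {0..n}, parcs = {0} \<times> {1..n} \<union> {1..n} \<times> {0} \<rparr>"

definition claw_plus :: "nat pair_pre_digraph" where
  "claw_plus = subdivide (star_graph 3) (0, 1) 4"

definition disjoint_union ::
  "'a pair_pre_digraph \<Rightarrow> 'b pair_pre_digraph \<Rightarrow> ('a + 'b) pair_pre_digraph" where
  "disjoint_union G H =
     \<lparr> pverts = pverts G <+> pverts H,
       parcs = map_prod Inl Inl ` parcs G \<union> map_prod Inr Inr ` parcs H \<rparr>"

definition copies :: "nat \<Rightarrow> 'a pair_pre_digraph \<Rightarrow> (nat \<times> 'a) pair_pre_digraph" where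
  "copies r G =
     \<lparr> pverts = {..<r} \<times> pverts G,
       parcs = {((i, u), (i, v)) | i u v. i < r \<and> (u, v) \<in> parcs G} \<rparr>"

end

theory Submission
  imports Defs
begin

text \<open>
  The double star with two leaves at each centre, and its variant in which the central edge is
  replaced by a path of length three, have \<open>vc < ivc\<close>. The second has no two adjacent vertices of
  degree three, so it does not contain the first; hence if \<open>H\<close> is contained in both, it is contained
  in the double star minus a vertex, which is \<open>K\<^sub>1\<^sub>,\<^sub>3\<^sup>+\<close> or \<open>2P\<^sub>1 + P\<^sub>3\<close>.

  Conversely, if \<open>vc < ivc\<close>, some component has a vertex cover \<open>S\<close> smaller than each of its sides
  \<open>A\<close> and \<open>B\<close>. Since \<open>|B \<inter> S| < |A - S|\<close>, by pigeonhole some \<open>q \<in> B \<inter> S\<close> has two neighbours in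
  \<open>A - S\<close>; with two vertices of \<open>B - S\<close> this is an induced \<open>2P\<^sub>1 + P\<^sub>3\<close>. Counting edges, some vertex
  \<open>v\<close> has degree at least three: a connected graph on more than \<open>2|S| + 1\<close> vertices has more than
  \<open>2|S|\<close> edges, all of them meeting \<open>S\<close>. If there were no induced \<open>K\<^sub>1\<^sub>,\<^sub>3\<^sup>+\<close>, a vertex sharing a
  neighbour with \<open>v\<close> would miss at most one neighbour of \<open>v\<close>. This propagates through the
  component, which becomes so close to complete bipartite that there is no room for two vertices in
  \<open>A - S\<close> not adjacent to two vertices in \<open>B - S\<close>.
\<close>

section \<open>Induced subgraphs as injective maps that preserve and reflect adjacency\<close>

lemma embeds_inducedI:
  assumes G: "pair_wf_digraph G" and H: "pair_wf_digraph H"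
    and inj: "inj_on f (pverts H)" and sub: "f ` pverts H \<subseteq> pverts G"
    and iff: "\<And>u v. u \<in> pverts H \<Longrightarrow> v \<in> pverts H \<Longrightarrow> (u, v) \<in> parcs H \<longleftrightarrow> (f u, f v) \<in> parcs G"
  shows "embeds_induced H G"
proof -
  interpret G: pair_wf_digraph G by fact
  interpret H: pair_wf_digraph H by fact
  \<comment> \<open>The copy of \<open>H\<close> inside \<open>G\<close> is its image
    \<open>?F\<close>. The isomorphism has to run from \<open>?F\<close> to \<open>H\<close>, so it
    is built from the inverse \<open>?g\<close> of \<open>f\<close>.\<close>
  let ?F = "\<lparr> pverts = f ` pverts H, parcs = map_prod f f ` parcs H \<rparr>"
  let ?g = "the_inv_into (pverts H) f"
  let ?iso = "\<lparr> iso_verts = ?g, iso_arcs = map_prod ?g ?g, iso_head = snd, iso_tail = fst \<rparr>"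
  have g: "?g (f u) = u" if "u \<in> pverts H" for u
    using inj that by (rule the_inv_into_f_f)
  have wfF: "pair_wf_digraph ?F"
    by unfold_locales (auto dest: H.in_arcsD1 H.in_arcsD2)
  have "subgraph (with_proj ?F) (with_proj G)"
    unfolding subgraph_def compatible_def
    using sub wfF G by (auto simp: wf_digraph_wp_iff iff[OF H.in_arcsD1 H.in_arcsD2, THEN iffD1])
  then have ind: "induced_subgraph (with_proj ?F) (with_proj G)"
    unfolding induced_subgraph_def
    using iff by (auto simp: image_iff dest: H.in_arcsD1 H.in_arcsD2) force+
  have "map_prod ?g ?g ` map_prod f f ` parcs H = parcs H"
  proof -
    have "map_prod ?g ?g (map_prod f f e) = e" if "e \<in> parcs H" for e
      using that by (cases e) (simp add: g H.in_arcsD1 H.in_arcsD2)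
    then show ?thesis by (simp add: image_image)
  qed
  moreover have "inj_on (map_prod ?g ?g) (map_prod f f ` parcs H)"
    by (rule inj_on_inverseI[of _ "map_prod f f"]) (auto simp: g H.in_arcsD1 H.in_arcsD2)
  moreover have "?g ` f ` pverts H = pverts H"
    by (simp add: image_image g)
  moreover have "inj_on ?g (f ` pverts H)"
    by (rule inj_onI) (auto simp: g)
  ultimately have "digraph_iso (with_proj ?F) (with_proj H)"
    unfolding digraph_iso_def pre_digraph.digraph_isomorphism_def app_iso_def
    using wfF
    by (intro exI[of _ ?iso])
      (auto simp: wf_digraph_wp_iff g H.in_arcsD1 H.in_arcsD2 intro!: pre_digraph.equality)
  with ind show ?thesis
    unfolding embeds_induced_def by blast
qed

lemma embeds_inducedE:
  assumes "embeds_induced H G"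
  obtains f where "inj_on f (pverts H)" "f ` pverts H \<subseteq> pverts G"
    "\<And>u v. u \<in> pverts H \<Longrightarrow> v \<in> pverts H \<Longrightarrow> (u, v) \<in> parcs H \<longleftrightarrow> (f u, f v) \<in> parcs G"
proof -
  from assms obtain F iso where F: "induced_subgraph (with_proj F) (with_proj G)"
    and iso: "pre_digraph.digraph_isomorphism (with_proj F) iso"
    and H: "with_proj H = app_iso iso (with_proj F)"
    unfolding embeds_induced_def digraph_iso_def by blast
  let ?h = "iso_verts iso"
  let ?f = "the_inv_into (pverts F) ?h"
  from F have sub: "pverts F \<subseteq> pverts G"
    and arcs: "parcs F = {e \<in> parcs G. fst e \<in> pverts F \<and> snd e \<in> pverts F}"
    by (auto simp: induced_subgraph_def subgraph_def)
  from iso have inj: "inj_on ?h (pverts F)"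
    by (simp add: pre_digraph.digraph_isomorphism_def)
  from H have vH: "pverts H = ?h ` pverts F" and aH: "parcs H = iso_arcs iso ` parcs F"
    and "iso_tail iso = fst" "iso_head iso = snd"
    by (simp_all add: app_iso_def with_proj_def)
  \<comment> \<open>An isomorphism carries its own map on arcs. It respects tails and heads, which
    are \<open>fst\<close> and \<open>snd\<close> on both sides, so it must act componentwise as
    \<open>?h\<close>.\<close>
  with iso have "iso_arcs iso e = map_prod ?h ?h e" if "e \<in> parcs F" for e
    using that by (cases e) (force simp: pre_digraph.digraph_isomorphism_def prod_eq_iff)
  with aH have aH: "parcs H = map_prod ?h ?h ` parcs F" by simp
  have f: "?f (?h u) = u" if "u \<in> pverts F" for u
    using inj that by (rule the_inv_into_f_f)
  have inj': "inj_on ?f (pverts H)"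
    unfolding vH by (rule inj_onI) (auto simp: f)
  have sub': "?f ` pverts H \<subseteq> pverts G"
    using sub by (auto simp: vH f)
  have iff: "(u, v) \<in> parcs H \<longleftrightarrow> (?f u, ?f v) \<in> parcs G"
    if uv: "u \<in> pverts H" "v \<in> pverts H" for u v
  proof -
    from uv obtain u' v' where *: "u = ?h u'" "v = ?h v'" "u' \<in> pverts F" "v' \<in> pverts F"
      unfolding vH by blast
    with inj have "(u, v) \<in> parcs H \<longleftrightarrow> (u', v') \<in> parcs F"
      unfolding aH by (auto simp: arcs map_prod_def image_iff inj_on_eq_iff)
    with * show ?thesis by (simp add: f arcs)
  qed
  show thesis
    using inj' sub' iff by (rule that)
qed

lemma embeds_induced_trans:
  assumes "pair_wf_digraph H" "pair_wf_digraph G" "embeds_induced H K" "embeds_induced K G"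
  shows "embeds_induced H G"
proof -
  obtain f where f: "inj_on f (pverts H)" "f ` pverts H \<subseteq> pverts K"
    "\<And>u v. u \<in> pverts H \<Longrightarrow> v \<in> pverts H \<Longrightarrow> (u, v) \<in> parcs H \<longleftrightarrow> (f u, f v) \<in> parcs K"
    using embeds_inducedE[OF assms(3)] by blast
  obtain g where g: "inj_on g (pverts K)" "g ` pverts K \<subseteq> pverts G"
    "\<And>u v. u \<in> pverts K \<Longrightarrow> v \<in> pverts K \<Longrightarrow> (u, v) \<in> parcs K \<longleftrightarrow> (g u, g v) \<in> parcs G"
    using embeds_inducedE[OF assms(4)] by blast
  show ?thesis
  proof (rule embeds_inducedI[where f = "g \<circ> f"])
    show "inj_on (g \<circ> f) (pverts H)"
      using f g by (meson comp_inj_on inj_on_subset)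
    show "(g \<circ> f) ` pverts H \<subseteq> pverts G"
      using f(2) g(2) by auto
    show "(u, v) \<in> parcs H \<longleftrightarrow> ((g \<circ> f) u, (g \<circ> f) v) \<in> parcs G"
      if "u \<in> pverts H" "v \<in> pverts H" for u v
      using that f(2) f(3)[OF that] g(3)[of "f u" "f v"] by auto
  qed (use assms in auto)
qed

section \<open>Explicit forms of the two target graphs\<close>

text \<open>Subdividing the edge between \<open>0\<close> and \<open>1\<close> puts \<open>4\<close>
  on it: \<open>4\<close> is the subdivision vertex, \<open>1\<close> its outer end,
  \<open>2\<close> and \<open>3\<close> are the remaining leaves.\<close>

lemma claw_plus_simps [simp]:
  "pverts claw_plus = {0, 1, 2, 3, 4}"
  "parcs claw_plus = {(0, 2), (2, 0), (0, 3), (3, 0), (0, 4), (4, 0), (4, 1), (1, 4)}"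
  by (auto simp: claw_plus_def star_graph_def subdivide.simps)

lemma pair_wf_digraph_claw_plus: "pair_wf_digraph claw_plus"
  by unfold_locales auto

definition two_P1_P3 :: "(nat \<times> nat + nat) pair_pre_digraph" where
  "two_P1_P3 = disjoint_union (copies 2 (path_graph 1)) (path_graph 3)"

lemma two_P1_P3_simps [simp]:
  "pverts two_P1_P3 = {Inl (0, 0), Inl (1, 0), Inr 0, Inr 1, Inr 2}"
  "parcs two_P1_P3 = {(Inr 0, Inr 1), (Inr 1, Inr 0), (Inr 1, Inr 2), (Inr 2, Inr 1)}"
proof -
  have 3: "{..<3} = {0, 1, 2 :: nat}" and 2: "{..<2} = {0, 1 :: nat}" by auto
  have "parcs (path_graph 1) = {}" by (auto simp: path_graph_def)
  moreover have "parcs (path_graph 3) = {(0, 1), (1, 0), (1, 2), (2, 1)}"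
    by (auto simp: path_graph_def)
  moreover have "pverts (path_graph 1) = {0}" "pverts (path_graph 3) = {0, 1, 2}"
    by (auto simp: path_graph_def)
  ultimately show "pverts two_P1_P3 = {Inl (0, 0), Inl (1, 0), Inr 0, Inr 1, Inr 2}"
    "parcs two_P1_P3 = {(Inr 0, Inr 1), (Inr 1, Inr 0), (Inr 1, Inr 2), (Inr 2, Inr 1)}"
    by (auto simp: two_P1_P3_def disjoint_union_def copies_def 2)
qed

lemma pair_wf_digraph_two_P1_P3: "pair_wf_digraph two_P1_P3"
  by unfold_locales auto

section \<open>Vertex covers and the minima \<open>vc\<close> and \<open>ivc\<close>\<close>

lemma independent_set_iff:
  "independent_set G S \<longleftrightarrow> S \<subseteq> pverts G \<and> (\<forall>u\<in>S. \<forall>v\<in>S. (u, v) \<notin> parcs G)"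
  by (auto simp: independent_set_def)

lemma vertex_cover_iff:
  assumes "pair_wf_digraph G"
  shows "vertex_cover G S \<longleftrightarrow> S \<subseteq> pverts G \<and> (\<forall>(u, v)\<in>parcs G. u \<in> S \<or> v \<in> S)"
  using pair_wf_digraph.in_arcsD1[OF assms] pair_wf_digraph.in_arcsD2[OF assms]
  by (fastforce simp: vertex_cover_def)

lemma vc_le: "vertex_cover G S \<Longrightarrow> vc G \<le> card S"
  unfolding vc_def by (rule Least_le) blast

lemma ivc_le: "vertex_cover G S \<Longrightarrow> independent_set G S \<Longrightarrow> ivc G \<le> card S"
  unfolding ivc_def by (rule Least_le) blast

lemma vc_attained: obtains S where "vertex_cover G S" "card S = vc G"
proof -
  have "vertex_cover G (pverts G)" by (simp add: vertex_cover_def)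
  then have "\<exists>k S. vertex_cover G S \<and> card S = k" by blast
  then have "\<exists>S. vertex_cover G S \<and> card S = vc G" unfolding vc_def by (rule LeastI_ex)
  with that show thesis by blast
qed

lemma ivc_attained:
  assumes "bipartite G"
  obtains S where "vertex_cover G S" "independent_set G S" "card S = ivc G"
proof -
  have "\<exists>k S. vertex_cover G S \<and> independent_set G S \<and> card S = k"
    using assms by (auto simp: bipartite_iff_independent_vertex_cover)
  then have "\<exists>S. vertex_cover G S \<and> independent_set G S \<and> card S = ivc G"
    unfolding ivc_def by (rule LeastI_ex)
  with that show thesis by blast
qed

section \<open>Connected bipartite graphs with a cover smaller than both sides\<close>

text \<open>Models one component of a bipartite graph. Connectedness says that a nonempty set closed
  under adjacency is everything. \<open>E\<close> may have arcs outside \<open>A \<union> B\<close>,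
  so the arc set of the whole graph serves for each component.\<close>

locale small_cover =
  fixes E :: "('v \<times> 'v) set" and A B S :: "'v set"
  assumes finite_sides: "finite A" "finite B" and disjoint: "A \<inter> B = {}"
    and sym: "(u, v) \<in> E \<Longrightarrow> (v, u) \<in> E"
    and A_to_B: "(u, v) \<in> E \<Longrightarrow> u \<in> A \<Longrightarrow> v \<in> B"
    and B_to_A: "(u, v) \<in> E \<Longrightarrow> u \<in> B \<Longrightarrow> v \<in> A"
    and connected: "T \<subseteq> A \<union> B \<Longrightarrow> T \<noteq> {} \<Longrightarrow>
      (\<And>u v. u \<in> T \<Longrightarrow> (u, v) \<in> E \<Longrightarrow> v \<in> T) \<Longrightarrow> T = A \<union> B"
    and cover_subset: "S \<subseteq> A \<union> B"
    and cover: "(u, v) \<in> E \<Longrightarrow> u \<in> A \<Longrightarrow> u \<in> S \<or> v \<in> S"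
    and small: "card S < card A" "card S < card B"
begin

text \<open>Only \<open>cover\<close> is stated asymmetrically, and \<open>sym\<close> repairs that.
  Each fact proved for \<open>A\<close> is thus available for \<open>B\<close> through the
  interpretation \<open>BA\<close>.\<close>

lemma swap: "small_cover E B A S"
proof
  show "T = B \<union> A" if "T \<subseteq> B \<union> A" "T \<noteq> {}" "\<And>u v. u \<in> T \<Longrightarrow> (u, v) \<in> E \<Longrightarrow> v \<in> T" for T
    using connected[of T] that by (simp add: Un_commute)
  show "u \<in> S \<or> v \<in> S" if "(u, v) \<in> E" "u \<in> B" for u v
    using cover[OF sym[OF that(1)]] B_to_A that by blast
qed (use finite_sides disjoint cover_subset small in \<open>auto intro: sym A_to_B B_to_A\<close>)

lemma not_in_both: "u \<in> A \<Longrightarrow> u \<notin> B"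
  using disjoint by blast

text \<open>An isolated vertex would be a closed set on its own and leave the other side empty, yet
  \<open>card S < card B\<close>.\<close>

lemma neighbour:
  assumes "u \<in> A" obtains v where "(u, v) \<in> E" "v \<in> B"
proof -
  have "\<exists>v. (u, v) \<in> E"
  proof (rule ccontr)
    assume "\<nexists>v. (u, v) \<in> E"
    then have "{u} = A \<union> B" using assms by (intro connected) auto
    then have "B \<subseteq> {u}" by blast
    with assms disjoint have "B = {}" by blast
    with small show False by simp
  qed
  then obtain v where "(u, v) \<in> E" by blast
  with A_to_B[OF this assms] that show thesis by blast
qed

lemma card_cover: "card S = card (A \<inter> S) + card (B \<inter> S)"
proof -
  have "card S = card ((A \<inter> S) \<union> (B \<inter> S))"
    using cover_subset by (intro arg_cong[of _ _ card]) blast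
  also have "\<dots> = card (A \<inter> S) + card (B \<inter> S)"
    using finite_sides disjoint by (intro card_Un_disjoint) auto
  finally show ?thesis .
qed

text \<open>Subtract \<open>card (A \<inter> S)\<close> from both sides of
  \<open>card S < card A\<close>.\<close>

lemma card_uncovered: "card (B \<inter> S) < card (A - S)"
  using card_cover small card_Diff_subset_Int[of A S] finite_sides by (simp add: less_diff_conv)

text \<open>A first uncovered vertex has a neighbour, which must lie in \<open>B \<inter> S\<close>;
  so the smaller side of \<open>card_uncovered\<close> is at least one and the larger at least
  two.\<close>

lemma two_uncovered: obtains x1 x2 where "x1 \<in> A - S" "x2 \<in> A - S" "x1 \<noteq> x2"
proof -
  have "A - S \<noteq> {}" using card_uncovered by (metis card.empty not_less_zero)
  then obtain x where x: "x \<in> A" "x \<notin> S" by blast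
  then obtain y where "y \<in> B \<inter> S" using neighbour[of x] cover by blast
  then have "0 < card (B \<inter> S)" using finite_sides by (metis card_gt_0_iff empty_iff finite_Int)
  with card_uncovered have "2 \<le> card (A - S)" by linarith
  then have "\<not> card (A - S) \<le> Suc 0" by linarith
  then show thesis using that by (metis card_le_Suc0_iff_eq finite_Diff finite_sides(1))
qed

lemma covering_vertex_with_two_uncovered:
  obtains q x1 x2 where "q \<in> B \<inter> S" "x1 \<in> A - S" "x2 \<in> A - S" "x1 \<noteq> x2"
    "(q, x1) \<in> E" "(q, x2) \<in> E"
proof -
  have "\<exists>q. (x, q) \<in> E \<and> q \<in> B \<inter> S" if "x \<in> A - S" for x
    using that neighbour[of x] cover by blast
  \<comment> \<open>An edge at an uncovered vertex is covered at its other end, so \<open>f\<close>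
    maps \<open>A - S\<close> into the smaller set \<open>B \<inter> S\<close> and two vertices
    collide.\<close>
  then obtain f where f: "\<And>x. x \<in> A - S \<Longrightarrow> (x, f x) \<in> E \<and> f x \<in> B \<inter> S" by metis
  have "\<not> inj_on f (A - S)"
  proof
    assume "inj_on f (A - S)"
    then have "card (A - S) \<le> card (B \<inter> S)"
      by (rule card_inj_on_le) (use f finite_sides in auto)
    with card_uncovered show False by simp
  qed
  then obtain x1 x2 where x: "x1 \<in> A - S" "x2 \<in> A - S" "x1 \<noteq> x2" "f x1 = f x2"
    unfolding inj_on_def by blast
  then have "(f x1, x1) \<in> E" "(f x1, x2) \<in> E" using f[of x1] f[of x2] sym by auto
  with x f[of x1] that show thesis by blast
qed

text \<open>Grow a vertex set one vertex at a time; connectedness supplies each new vertex together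
  with a new edge. Intersecting with \<open>A \<times> B\<close> counts each undirected edge
  once.\<close>

lemma connected_card_le_edges: "card (A \<union> B) \<le> card (E \<inter> A \<times> B) + 1"
proof -
  have ex: "\<exists>T \<subseteq> A \<union> B. card T = Suc n \<and> n \<le> card (E \<inter> A \<times> B \<inter> T \<times> T)"
    if "Suc n \<le> card (A \<union> B)" for n
    using that
  proof (induction n)
    case 0
    then obtain u where "u \<in> A \<union> B" by (metis One_nat_def card.empty ex_in_conv not_one_le_zero)
    then show ?case by (intro exI[of _ "{u}"]) auto
  next
    case (Suc n)
    then obtain T where T: "T \<subseteq> A \<union> B" "card T = Suc n" "n \<le> card (E \<inter> A \<times> B \<inter> T \<times> T)"
      by auto
    have finT: "finite T" using T(1) finite_sides finite_subset by blast
    from T(2) Suc.prems have "T \<noteq> A \<union> B" "T \<noteq> {}" by auto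
    then obtain u v where uv: "u \<in> T" "(u, v) \<in> E" "v \<notin> T" using connected[of T] T(1) by blast
    then have vAB: "v \<in> A \<union> B" using T(1) A_to_B B_to_A by blast
    \<comment> \<open>The edge leaving \<open>T\<close>, oriented from \<open>A\<close> to
      \<open>B\<close>; it is new because \<open>v\<close> is not in \<open>T\<close>.\<close>
    define e where "e = (if u \<in> A then (u, v) else (v, u))"
    have e: "e \<in> E \<inter> A \<times> B \<inter> insert v T \<times> insert v T - E \<inter> A \<times> B \<inter> T \<times> T"
      using uv T(1) A_to_B B_to_A sym by (auto simp: e_def)
    have "card (insert e (E \<inter> A \<times> B \<inter> T \<times> T)) \<le> card (E \<inter> A \<times> B \<inter> insert v T \<times> insert v T)"
      using e finite_sides by (intro card_mono) auto
    moreover have "card (insert e (E \<inter> A \<times> B \<inter> T \<times> T)) = Suc (card (E \<inter> A \<times> B \<inter> T \<times> T))"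
      using e finite_sides by (subst card_insert_disjoint) auto
    ultimately have "Suc n \<le> card (E \<inter> A \<times> B \<inter> insert v T \<times> insert v T)"
      using T(3) by linarith
    moreover have "card (insert v T) = Suc (Suc n)" using uv finT T(2) by simp
    ultimately show ?case using T(1) vAB by (intro exI[of _ "insert v T"]) auto
  qed
  have "card (A \<union> B) \<noteq> 0" using small finite_sides by auto
  then obtain n where n: "card (A \<union> B) = Suc n" using not0_implies_Suc by blast
  with ex[of n] obtain T where T: "n \<le> card (E \<inter> A \<times> B \<inter> T \<times> T)" by auto
  have "card (E \<inter> A \<times> B \<inter> T \<times> T) \<le> card (E \<inter> A \<times> B)"
    using finite_sides by (intro card_mono) auto
  with n T show ?thesis by simp
qed

lemma vertex_of_degree_3:
  obtains v where "v \<in> A \<union> B" "3 \<le> card (E `` {v})"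
proof -
  have "\<exists>v\<in>A \<union> B. 3 \<le> card (E `` {v})"
  proof (rule ccontr)
    assume "\<not> ?thesis"
    then have deg: "card (E `` {v}) \<le> 2" if "v \<in> A \<union> B" for v
      using that by force
    have fin: "finite (E `` {v})" if "v \<in> A \<union> B" for v
      by (rule finite_subset[of _ "A \<union> B"]) (use that A_to_B B_to_A finite_sides in auto)
    \<comment> \<open>The edges, oriented from \<open>A\<close> to \<open>B\<close>, whose end in
      \<open>A\<close> (for \<open>?P\<close>) or in \<open>B\<close> (for \<open>?Q\<close>)
      belongs to \<open>S\<close>. Each vertex of \<open>S\<close> contributes at most two.\<close>
    let ?P = "\<Union>s\<in>A \<inter> S. {s} \<times> E `` {s}" and ?Q = "\<Union>s\<in>B \<inter> S. E `` {s} \<times> {s}"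
    have finS: "finite (A \<inter> S)" "finite (B \<inter> S)" using finite_sides by auto
    have "card ?P \<le> (\<Sum>s\<in>A \<inter> S. card ({s} \<times> E `` {s}))" by (rule card_UN_le) fact
    also have "\<dots> \<le> card (A \<inter> S) * 2"
      by (rule sum_bounded_above[of _ _ "2 :: nat", simplified]) (use deg in \<open>auto simp: card_cartesian_product\<close>)
    finally have P: "card ?P \<le> card (A \<inter> S) * 2" .
    have "card ?Q \<le> (\<Sum>s\<in>B \<inter> S. card (E `` {s} \<times> {s}))" by (rule card_UN_le) fact
    also have "\<dots> \<le> card (B \<inter> S) * 2"
      by (rule sum_bounded_above[of _ _ "2 :: nat", simplified]) (use deg in \<open>auto simp: card_cartesian_product\<close>)
    finally have Q: "card ?Q \<le> card (B \<inter> S) * 2" .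
    have "finite (?P \<union> ?Q)" using finS fin by auto
    then have "card (E \<inter> A \<times> B) \<le> card (?P \<union> ?Q)"
    proof (rule card_mono, intro subsetI)
      fix e assume e: "e \<in> E \<inter> A \<times> B"
      then obtain a b where "e = (a, b)" "(a, b) \<in> E" "a \<in> A" "b \<in> B" by blast
      with cover[of a b] sym[of a b] show "e \<in> ?P \<union> ?Q" by auto
    qed
    also have "\<dots> \<le> card ?P + card ?Q" by (rule card_Un_le)
    also have "\<dots> \<le> card (A \<inter> S) * 2 + card (B \<inter> S) * 2"
      using P Q by (rule add_mono)
    finally have "card (E \<inter> A \<times> B) \<le> card (A \<inter> S) * 2 + card (B \<inter> S) * 2" .
    moreover have "card (A \<union> B) = card A + card B"
      using finite_sides disjoint by (rule card_Un_disjoint)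
    \<comment> \<open>Both sides have at least \<open>card S + 1\<close> vertices, so there are at
      least \<open>2 * card S + 1\<close> edges, against at most \<open>2 * card S\<close>.\<close>
    ultimately show False using connected_card_le_edges card_cover small by linarith
  qed
  with that show thesis by blast
qed

text \<open>
  In a bipartite graph an induced \<open>K\<^sub>1\<^sub>,\<^sub>3\<^sup>+\<close> is exactly a violation of the hypothesis below: \<open>v\<close> is
  the centre, \<open>a\<close> and \<open>b\<close> are leaves, and \<open>w\<close> is the subdivision vertex, with end \<open>u\<close>.
\<close>

lemma claw_at_degree_3:
  assumes claw_free: "\<And>v a b w u. v \<in> A \<union> B \<Longrightarrow> (v, a) \<in> E \<Longrightarrow> (v, b) \<in> E \<Longrightarrow> (v, w) \<in> E \<Longrightarrow>
      (w, u) \<in> E \<Longrightarrow> distinct [a, b, w] \<Longrightarrow> u \<noteq> v \<Longrightarrow> (u, a) \<in> E \<or> (u, b) \<in> E"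
    and v: "v \<in> A" "3 \<le> card (E `` {v})"
  shows False
proof -
  \<comment> \<open>If \<open>u\<close> and \<open>v\<close> share a neighbour, then
    \<open>u\<close> misses at most one neighbour of \<open>v\<close>. The distinctness conditions
    disappear because in the degenerate cases one of the two edges is already given.\<close>
  have miss: "(u, a) \<in> E \<or> (u, b) \<in> E"
    if "v \<in> A \<union> B" "(v, w) \<in> E" "(u, w) \<in> E" "(v, a) \<in> E" "(v, b) \<in> E" "a \<noteq> b" for u v w a b
    using that claw_free[of v a b w u] sym[of u w] by (cases "u = v"; cases "a = w"; cases "b = w") auto
  obtain c d e where c: "(v, c) \<in> E" "(v, d) \<in> E" "(v, e) \<in> E" "c \<noteq> d" "d \<noteq> e" "c \<noteq> e"
  proof -
    obtain N where "N \<subseteq> E `` {v}" "card N = 3"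
      using v(2) by (metis obtain_subset_with_card_n)
    then show thesis using that by (auto simp: card_3_iff)
  qed
  \<comment> \<open>\<open>u\<close> misses at most one of \<open>c\<close>, \<open>d\<close>,
    \<open>e\<close>.\<close>
  have two_common: "\<exists>a b. a \<noteq> b \<and> (v, a) \<in> E \<and> (v, b) \<in> E \<and> (u, a) \<in> E \<and> (u, b) \<in> E"
    if "(v, w) \<in> E" "(u, w) \<in> E" for u w
    using miss[of v w u c d] miss[of v w u c e] miss[of v w u d e] c that v(1) by (metis UnI1)
  \<comment> \<open>The vertices of \<open>A\<close> sharing a neighbour with \<open>v\<close>, and
    all neighbours of these. Closure of \<open>T\<close> shows that every vertex of \<open>A\<close>
    shares a neighbour with \<open>v\<close>.\<close>
  define T where "T = {u \<in> A. \<exists>w. (v, w) \<in> E \<and> (u, w) \<in> E} \<union>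
    {z \<in> B. \<exists>u w. u \<in> A \<and> (v, w) \<in> E \<and> (u, w) \<in> E \<and> (u, z) \<in> E}"
  have "T = A \<union> B"
  proof (rule connected)
    show "T \<subseteq> A \<union> B" by (auto simp: T_def)
    show "T \<noteq> {}" using v(1) c(1) by (auto simp: T_def)
    fix z t assume z: "z \<in> T" and zt: "(z, t) \<in> E"
    show "t \<in> T"
    proof (cases "z \<in> A")
      case True
      then show ?thesis using z zt A_to_B not_in_both unfolding T_def by blast
    next
      case False
      with z obtain u w where u: "z \<in> B" "u \<in> A" "(v, w) \<in> E" "(u, w) \<in> E" "(u, z) \<in> E"
        unfolding T_def by blast
      from two_common[OF u(3,4)] obtain a b where ab: "a \<noteq> b"
        "(v, a) \<in> E" "(v, b) \<in> E" "(u, a) \<in> E" "(u, b) \<in> E" by blast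
      \<comment> \<open>\<open>t\<close> shares \<open>z\<close> with \<open>u\<close>, hence
        reaches \<open>a\<close> or \<open>b\<close>, and both are neighbours of
        \<open>v\<close>.\<close>
      have "(t, a) \<in> E \<or> (t, b) \<in> E"
        using miss[of u z t a b] u sym[OF zt] ab by blast
      with ab u(1) zt B_to_A show ?thesis unfolding T_def by blast
    qed
  qed
  then have to_v: "\<exists>w. (v, w) \<in> E \<and> (u, w) \<in> E" if "u \<in> A" for u
    using that not_in_both unfolding T_def by blast
  \<comment> \<open>Each of \<open>u\<close> and \<open>u'\<close> misses at most one of
    \<open>c\<close>, \<open>d\<close>, \<open>e\<close>, so one of the three is adjacent to
    both.\<close>
  have common: "\<exists>w. (u, w) \<in> E \<and> (u', w) \<in> E" if "u \<in> A" "u' \<in> A" for u u'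
  proof -
    from to_v that obtain w w' where w: "(v, w) \<in> E" "(u, w) \<in> E" "(v, w') \<in> E" "(u', w') \<in> E"
      by blast
    show ?thesis
      using miss[of v w u c d] miss[of v w u c e] miss[of v w u d e]
        miss[of v w' u' c d] miss[of v w' u' c e] miss[of v w' u' d e] c v(1) w by blast
  qed
  interpret BA: small_cover E B A S by (rule swap)
  obtain y where y: "y \<in> B - S" using BA.two_uncovered by blast
  \<comment> \<open>A neighbour \<open>u\<close> of \<open>y\<close> with a second neighbour
    \<open>a\<close>. If \<open>v\<close> is not adjacent to \<open>y\<close>, any neighbour of
    \<open>y\<close> will do: what it shares with \<open>v\<close> differs from
    \<open>y\<close>.\<close>
  obtain u a where u: "u \<in> A" "(u, y) \<in> E" "(u, a) \<in> E" "a \<noteq> y"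
  proof (cases "(v, y) \<in> E")
    case True
    with that v(1) c show thesis by metis
  next
    case False
    obtain u where u: "(y, u) \<in> E" "u \<in> A" using BA.neighbour y by blast
    with to_v obtain w where "(v, w) \<in> E" "(u, w) \<in> E" by blast
    with that u sym False show thesis by metis
  qed
  obtain x1 x2 where x: "x1 \<in> A - S" "x2 \<in> A - S" "x1 \<noteq> x2" by (rule two_uncovered)
  have not_y: "(x, y) \<notin> E" if "x \<in> A - S" for x
    using cover[of x y] that y by blast
  \<comment> \<open>\<open>x\<close> shares a neighbour with \<open>u\<close> and misses
    \<open>y\<close>, both \<open>x\<close> and \<open>y\<close> being uncovered; so it cannot miss
    \<open>a\<close> as well.\<close>
  have "(x, a) \<in> E" if x: "x \<in> A - S" for x
  proof -
    obtain w where "(u, w) \<in> E" "(x, w) \<in> E" using common[of u x] u(1) x by blast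
    with miss[of u w x a y] u not_y[OF x] show ?thesis by blast
  qed
  with x(1,2) have "(a, x1) \<in> E" "(a, x2) \<in> E" by (auto intro: sym)
  moreover have "a \<in> A \<union> B" "(a, u) \<in> E" "(y, u) \<in> E" using u(1) A_to_B[OF u(3,1)] sym[OF u(3)] sym[OF u(2)] by auto
  \<comment> \<open>The forbidden graph sits at centre \<open>a\<close>, with leaves
    \<open>x1\<close>, \<open>x2\<close>, subdivision vertex \<open>u\<close> and end
    \<open>y\<close>.\<close>
  ultimately show False
    using miss[of a u y x1 x2] x(3) not_y[OF x(1)] not_y[OF x(2)] sym[of y x1] sym[of y x2] by blast
qed

text \<open>The vertex of degree three may lie on either side, so \<open>claw_at_degree_3\<close> is
  used directly or through \<open>swap\<close>.\<close>

lemma claw_plus_pattern: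
  obtains (claw) v a b w u where "v \<in> A \<union> B" "(v, a) \<in> E" "(v, b) \<in> E" "(v, w) \<in> E" "(w, u) \<in> E"
    "distinct [a, b, w]" "u \<noteq> v" "(u, a) \<notin> E" "(u, b) \<notin> E"
proof (rule ccontr)
  assume "\<not> thesis"
  then have claw_free: "(u, a) \<in> E \<or> (u, b) \<in> E"
    if "v \<in> A \<union> B" "(v, a) \<in> E" "(v, b) \<in> E" "(v, w) \<in> E"
      "(w, u) \<in> E" "distinct [a, b, w]" "u \<noteq> v" for v a b w u
    using claw[OF that] by blast
  interpret BA: small_cover E B A S by (rule swap)
  obtain v where "v \<in> A \<union> B" and v3: "3 \<le> card (E `` {v})" by (rule vertex_of_degree_3)
  then consider "v \<in> A" | "v \<in> B" by blast
  then show False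
  proof cases
    case 1
    show False by (rule claw_at_degree_3[OF claw_free 1 v3])
  next
    case 2
    show False by (rule BA.claw_at_degree_3[OF claw_free[unfolded Un_commute[of A]] 2 v3])
  qed
qed

end

section \<open>Both target graphs as induced subgraphs\<close>

lemma (in small_cover) embeds_two_P1_P3:
  assumes G: "pair_wf_digraph G" "parcs G = E" "A \<union> B \<subseteq> pverts G"
  shows "embeds_induced two_P1_P3 G"
proof -
  interpret BA: small_cover E B A S by (rule swap)
  obtain q x1 x2 where q: "q \<in> B \<inter> S" "x1 \<in> A - S" "x2 \<in> A - S" "x1 \<noteq> x2"
    "(q, x1) \<in> E" "(q, x2) \<in> E" by (rule covering_vertex_with_two_uncovered)
  obtain y1 y2 where y: "y1 \<in> B - S" "y2 \<in> B - S" "y1 \<noteq> y2" by (rule BA.two_uncovered)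
  \<comment> \<open>The path goes to \<open>x1\<close>, \<open>q\<close>, \<open>x2\<close> and the
    isolated vertices to \<open>y1\<close>, \<open>y2\<close>. These share a side with
    \<open>q\<close>, and no edge joins them to \<open>x1\<close> or \<open>x2\<close>, since it
    would be uncovered.\<close>
  let ?f = "case_sum (\<lambda>(i, _). [y1, y2] ! i) (\<lambda>i. [x1, q, x2] ! i)"
  have AA: "(u, v) \<notin> E" if "u \<in> A" "v \<in> A" for u v
    using A_to_B[of u v] that not_in_both by blast
  have BB: "(u, v) \<notin> E" if "u \<in> B" "v \<in> B" for u v
    using B_to_A[of u v] that not_in_both by blast
  have AB: "(x, y) \<notin> E" "(y, x) \<notin> E" if "x \<in> A - S" "y \<in> B - S" for x y
    using cover[of x y] sym[of y x] that by blast+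
  show ?thesis
  proof (rule embeds_inducedI[where f = ?f])
    show "inj_on ?f (pverts two_P1_P3)"
      using q y not_in_both[of x1] not_in_both[of x2] by (auto simp: inj_on_def)
    show "?f ` pverts two_P1_P3 \<subseteq> pverts G"
      using q y G(3) by auto
    have non_edges: "(x1, x1) \<notin> E" "(x1, x2) \<notin> E" "(x2, x1) \<notin> E" "(x2, x2) \<notin> E"
      "(y1, y1) \<notin> E" "(y1, y2) \<notin> E" "(y2, y1) \<notin> E" "(y2, y2) \<notin> E"
      "(q, q) \<notin> E" "(q, y1) \<notin> E" "(y1, q) \<notin> E" "(q, y2) \<notin> E" "(y2, q) \<notin> E"
      "(x1, y1) \<notin> E" "(y1, x1) \<notin> E" "(x1, y2) \<notin> E" "(y2, x1) \<notin> E"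
      "(x2, y1) \<notin> E" "(y1, x2) \<notin> E" "(x2, y2) \<notin> E" "(y2, x2) \<notin> E"
      using q(1-3) y(1,2) by (simp_all add: AA BB AB)
    have "\<forall>u\<in>pverts two_P1_P3. \<forall>v\<in>pverts two_P1_P3.
        (u, v) \<in> parcs two_P1_P3 \<longleftrightarrow> (?f u, ?f v) \<in> parcs G"
      by (simp add: G(2) non_edges q(5,6) sym[OF q(5)] sym[OF q(6)])
    then show "(u, v) \<in> parcs two_P1_P3 \<longleftrightarrow> (?f u, ?f v) \<in> parcs G"
      if "u \<in> pverts two_P1_P3" "v \<in> pverts two_P1_P3" for u v
      using that by blast
  qed (use G pair_wf_digraph_two_P1_P3 in auto)
qed

lemma (in small_cover) embeds_claw_plus:
  assumes G: "pair_wf_digraph G" "parcs G = E" "A \<union> B \<subseteq> pverts G"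
  shows "embeds_induced claw_plus G"
proof -
  obtain v a b w u where v: "v \<in> A \<union> B"
    and e: "(v, a) \<in> E" "(v, b) \<in> E" "(v, w) \<in> E" "(w, u) \<in> E"
    and d: "distinct [a, b, w]" "u \<noteq> v" and n: "(u, a) \<notin> E" "(u, b) \<notin> E"
    by (rule claw_plus_pattern)
  \<comment> \<open>Follows the numbering of \<open>claw_plus\<close>: centre, outer end, two
    leaves, subdivision vertex.\<close>
  let ?f = "\<lambda>n. [v, u, a, b, w] ! n"
  have edge: "x \<in> A \<union> B \<and> y \<in> A \<union> B \<and> (x \<in> A) \<noteq> (y \<in> A)" if "(x, y) \<in> E" "x \<in> A \<union> B" for x y
    using A_to_B[of x y] B_to_A[of x y] that not_in_both[of x] not_in_both[of y] by blast
  have in_AB: "a \<in> A \<union> B" "b \<in> A \<union> B" "w \<in> A \<union> B" "u \<in> A \<union> B"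
    using edge e v by blast+
  have side: "(a \<in> A) \<noteq> (v \<in> A)" "(b \<in> A) \<noteq> (v \<in> A)" "(w \<in> A) \<noteq> (v \<in> A)" "(u \<in> A) = (v \<in> A)"
    using edge[OF e(1) v] edge[OF e(2) v] edge[OF e(3) v] edge[OF e(4) in_AB(3)] by blast+
  \<comment> \<open>Bipartiteness excludes every unwanted edge except those from \<open>u\<close> to
    \<open>a\<close> and \<open>b\<close>, which \<open>n\<close> excludes.\<close>
  have no_edge: "(x, y) \<notin> E" if "(x \<in> A) = (y \<in> A)" "x \<in> A \<union> B" for x y
    using edge that by blast
  have n': "(a, u) \<notin> E" "(b, u) \<notin> E"
    using n sym by blast+
  show ?thesis
  proof (rule embeds_inducedI[where f = ?f])
    show "inj_on ?f (pverts claw_plus)"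
      using d side by (auto simp: inj_on_def)
    show "?f ` pverts claw_plus \<subseteq> pverts G"
      using v in_AB G(3) by auto
    have non_edges: "(v, v) \<notin> E" "(v, u) \<notin> E" "(u, v) \<notin> E" "(u, u) \<notin> E"
      "(a, a) \<notin> E" "(a, b) \<notin> E" "(a, w) \<notin> E" "(b, a) \<notin> E" "(b, b) \<notin> E" "(b, w) \<notin> E"
      "(w, a) \<notin> E" "(w, b) \<notin> E" "(w, w) \<notin> E"
      by (rule no_edge; use side v in_AB in blast)+
    have "\<forall>x\<in>pverts claw_plus. \<forall>y\<in>pverts claw_plus.
        (x, y) \<in> parcs claw_plus \<longleftrightarrow> (?f x, ?f y) \<in> parcs G"
      by (simp add: G(2) non_edges n n' e e[THEN sym])
    then show "(x, y) \<in> parcs claw_plus \<longleftrightarrow> (?f x, ?f y) \<in> parcs G"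
      if "x \<in> pverts claw_plus" "y \<in> pverts claw_plus" for x y
      using that by blast
  qed (use G pair_wf_digraph_claw_plus in auto)
qed

section \<open>From components to the whole graph\<close>

text \<open>
  An independent vertex cover may take, in each connected component separately, the smaller side.
\<close>

lemma ivc_eq_vcI:
  assumes G: "pair_graph G" "bipartite G"
    and not_small: "\<And>A B S. small_cover (parcs G) A B S \<Longrightarrow> A \<union> B \<subseteq> pverts G \<Longrightarrow> False"
  shows "ivc G = vc G"
proof (rule antisym)
  interpret pair_graph G by fact
  let ?E = "parcs G" and ?V = "pverts G"
  obtain I where "vertex_cover G I" "card I = ivc G" using ivc_attained G(2) by blast
  then show "vc G \<le> ivc G" using vc_le by metis
  obtain A B where AB: "A \<union> B = ?V" "A \<inter> B = {}"
    and ind: "independent_set G A" "independent_set G B"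
    using G(2) unfolding bipartite_def by blast
  obtain S where S: "vertex_cover G S" "card S = vc G" by (rule vc_attained)
  have cover: "S \<subseteq> ?V" "\<And>u v. (u, v) \<in> ?E \<Longrightarrow> u \<in> S \<or> v \<in> S"
    using S(1) vertex_cover_iff[OF pair_wf_digraph] by auto
  have E_sym: "(u, v) \<in> ?E \<Longrightarrow> (v, u) \<in> ?E" for u v
    by (rule arcs_symmetric)
  have A_to_B: "v \<in> B" if "(u, v) \<in> ?E" "u \<in> A" for u v
    using ind(1) in_arcsD2[OF that(1)] that AB unfolding independent_set_iff by blast
  have B_to_A: "v \<in> A" if "(u, v) \<in> ?E" "u \<in> B" for u v
    using ind(2) in_arcsD2[OF that(1)] that AB unfolding independent_set_iff by blast
  \<comment> \<open>The connected component of \<open>v\<close>; by symmetry of the arcs, components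
    form a partition.\<close>
  define C where "C v = ?E\<^sup>* `` {v}" for v
  have "sym (?E\<^sup>*)" using E_sym by (intro sym_rtrancl symI)
  then have C_eq: "C u = C v" if "(u, v) \<in> ?E\<^sup>*" for u v
    using that unfolding C_def by (auto dest: symD intro: rtrancl_trans)
  have C_self: "v \<in> C v" for v
    by (simp add: C_def)
  have C_step: "v \<in> C r" if "u \<in> C r" "(u, v) \<in> ?E" for u v r
    using that by (auto simp: C_def)
  have C_subset: "C v \<subseteq> ?V" if "v \<in> ?V" for v
  proof
    fix u assume "u \<in> C v"
    then have "(v, u) \<in> ?E\<^sup>*" by (simp add: C_def)
    then show "u \<in> ?V" using that by induction (auto dest: in_arcsD2)
  qed
  have fin: "finite ?V" "finite A" "finite B" "finite S"
    using pair_finite_verts AB(1) cover(1) by (auto intro: finite_subset)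
  \<comment> \<open>Otherwise \<open>S\<close> restricted to the component would be a
    \<open>small_cover\<close>.\<close>
  have side: "card (A \<inter> C r) \<le> card (S \<inter> C r) \<or> card (B \<inter> C r) \<le> card (S \<inter> C r)"
    if r: "r \<in> ?V" for r
  proof (rule ccontr)
    assume small: "\<not> ?thesis"
    have C_split: "A \<inter> C r \<union> B \<inter> C r = C r"
      using AB(1) C_subset[OF r] by blast
    have "small_cover ?E (A \<inter> C r) (B \<inter> C r) (S \<inter> C r)"
    proof
      fix T assume T: "T \<subseteq> A \<inter> C r \<union> B \<inter> C r" "T \<noteq> {}"
        and closed: "\<And>u v. u \<in> T \<Longrightarrow> (u, v) \<in> ?E \<Longrightarrow> v \<in> T"
      from T obtain t where t: "t \<in> T" "t \<in> C r" by blast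
      then have "C t = C r" using C_eq[of r t] by (simp add: C_def)
      moreover have "u \<in> T" if "u \<in> C t" for u
      proof -
        from that have "(t, u) \<in> ?E\<^sup>*" by (simp add: C_def)
        then show ?thesis using t(1) closed by induction auto
      qed
      ultimately show "T = A \<inter> C r \<union> B \<inter> C r" using T(1) C_split by blast
    next
      fix u v assume e: "(u, v) \<in> ?E"
      then show "(v, u) \<in> ?E" by (rule E_sym)
      show "v \<in> B \<inter> C r" if "u \<in> A \<inter> C r"
        using that A_to_B[OF e] C_step[OF _ e] by blast
      show "v \<in> A \<inter> C r" if "u \<in> B \<inter> C r"
        using that B_to_A[OF e] C_step[OF _ e] by blast
      show "u \<in> S \<inter> C r \<or> v \<in> S \<inter> C r" if "u \<in> A \<inter> C r"
        using that cover(2)[OF e] C_step[OF _ e] by blast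
    next
      show "S \<inter> C r \<subseteq> A \<inter> C r \<union> B \<inter> C r" using AB(1) cover(1) by blast
    qed (use fin AB(2) small in auto)
    then show False using not_small C_split C_subset[OF r] by blast
  qed
  \<comment> \<open>Where \<open>A\<close> is too large in a component, \<open>B\<close> is chosen,
    and \<open>side\<close> bounds it there. The choice depends only on the component, so it is
    constant along edges.\<close>
  define I where "I = {v \<in> ?V. if card (A \<inter> C v) \<le> card (S \<inter> C v) then v \<in> A else v \<in> B}"
  have C_edge: "C u = C v" if "(u, v) \<in> ?E" for u v
    using that by (intro C_eq) blast
  have "vertex_cover G I"
    unfolding vertex_cover_iff[OF pair_wf_digraph]
  proof (intro conjI ballI, safe)
    fix u v assume e: "(u, v) \<in> ?E" "v \<notin> I"
    then show "u \<in> I"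
      using C_edge[OF e(1)] in_arcsD1[OF e(1)] in_arcsD2[OF e(1)] A_to_B[OF e(1)] B_to_A[OF e(1)]
        A_to_B[OF E_sym[OF e(1)]] B_to_A[OF E_sym[OF e(1)]] AB(1)
      by (auto simp: I_def split: if_splits)
  qed (simp add: I_def)
  moreover have "independent_set G I"
    unfolding independent_set_iff
  proof (intro conjI ballI notI)
    fix u v assume "u \<in> I" "v \<in> I" and e: "(u, v) \<in> ?E"
    then show False
      using C_edge[OF e] A_to_B[OF e] B_to_A[OF e] AB(2)
      by (auto simp: I_def split: if_splits)
  qed (auto simp: I_def)
  ultimately have "ivc G \<le> card I" by (rule ivc_le)
  also have "card I \<le> card S"
  proof -
    \<comment> \<open>Splitting cardinalities over components reduces the comparison of
      \<open>I\<close> with \<open>S\<close> to one component.\<close>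
    have count: "card X = (\<Sum>D\<in>C ` ?V. card {v \<in> X. C v = D})" if "X \<subseteq> ?V" for X
      using sum.group[of X "C ` ?V" C "\<lambda>_. 1 :: nat"] that fin(1) finite_subset[OF that fin(1)]
      by (simp add: image_mono)
    have "card {v \<in> I. C v = D} \<le> card {v \<in> S. C v = D}" if "D \<in> C ` ?V" for D
    proof -
      from that obtain r where r: "r \<in> ?V" "D = C r" by blast
      have C_iff: "C v = C r \<longleftrightarrow> v \<in> C r" for v
        using C_self[of v] C_eq[of r v] by (auto simp: C_def)
      have "{v \<in> I. C v = D} = (if card (A \<inter> C r) \<le> card (S \<inter> C r) then A else B) \<inter> C r"
        using AB(1) unfolding r(2) by (auto simp: I_def C_iff[symmetric] split: if_splits)
      moreover have "{v \<in> S. C v = D} = S \<inter> C r"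
        unfolding r(2) C_iff by blast
      ultimately show ?thesis using side[OF r(1)] by auto
    qed
    moreover have "I \<subseteq> ?V" by (auto simp: I_def)
    ultimately show ?thesis
      by (simp add: count[OF cover(1)] count[of I] sum_mono)
  qed
  finally show "ivc G \<le> vc G" using S(2) by simp
qed

section \<open>Two trees with \<open>vc < ivc\<close>\<close>

text \<open>The counterexamples live on \<open>nat\<close>, the class on an arbitrary infinite type;
  injective renaming carries them over.\<close>

definition relabel :: "('a \<Rightarrow> 'b) \<Rightarrow> 'a pair_pre_digraph \<Rightarrow> 'b pair_pre_digraph" where
  "relabel f G = \<lparr> pverts = f ` pverts G, parcs = map_prod f f ` parcs G \<rparr>"

lemma relabel_simps [simp]:
  "pverts (relabel f G) = f ` pverts G"
  "parcs (relabel f G) = map_prod f f ` parcs G"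
  by (simp_all add: relabel_def)

lemma relabel_arc_iff:
  assumes "inj f"
  shows "(f u, f v) \<in> map_prod f f ` R \<longleftrightarrow> (u, v) \<in> R"
  using inj_image_mem_iff[OF prod.inj_map[OF assms assms], of "(u, v)" R] by simp

lemma pair_graph_relabel:
  assumes "pair_graph G" "inj f"
  shows "pair_graph (relabel f G)"
proof -
  interpret pair_graph G by fact
  show ?thesis
  proof
    show "symmetric (with_proj (relabel f G))"
      by (auto simp: symmetric_def intro!: symI arcs_symmetric)
  qed (use assms(2) pair_finite_verts pair_finite_arcs in
      \<open>auto dest: in_arcsD1 in_arcsD2 no_loops' simp: inj_eq\<close>)
qed

lemma embeds_induced_relabel:
  assumes "pair_wf_digraph H" "pair_wf_digraph G" "pair_wf_digraph (relabel f G)" "inj f"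
    "embeds_induced H (relabel f G)"
  shows "embeds_induced H G"
proof -
  have "embeds_induced (relabel f G) G"
  proof (rule embeds_inducedI[where f = "inv f", OF assms(2,3)])
    show "inj_on (inv f) (pverts (relabel f G))"
      by (rule inj_on_inv_into) auto
  qed (use assms(4) in \<open>auto simp: relabel_arc_iff\<close>)
  with assms(1,2,5) show ?thesis by (rule embeds_induced_trans)
qed

lemma vertex_cover_relabel:
  assumes "pair_wf_digraph G" "pair_wf_digraph (relabel f G)" "inj f"
  shows "vertex_cover (relabel f G) S \<longleftrightarrow> (\<exists>T. S = f ` T \<and> vertex_cover G T)"
proof -
  have image: "vertex_cover (relabel f G) (f ` T) \<longleftrightarrow> vertex_cover G T" for T
    unfolding vertex_cover_iff[OF assms(1)] vertex_cover_iff[OF assms(2)]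
    by (simp add: inj_image_mem_iff[OF assms(3)] inj_image_subset_iff[OF assms(3)] case_prod_beta)
  have "\<exists>T. S = f ` T" if "vertex_cover (relabel f G) S"
    using that by (auto simp: vertex_cover_def subset_image_iff)
  with image show ?thesis by metis
qed

lemma independent_set_relabel:
  assumes "inj f"
  shows "independent_set (relabel f G) (f ` T) \<longleftrightarrow> independent_set G T"
  by (simp add: independent_set_iff inj_image_subset_iff[OF assms] relabel_arc_iff[OF assms])

text \<open>A copy of \<open>K\<close> on \<open>'b\<close> belongs to the class, \<open>I\<close>
  showing that it is bipartite, and satisfies \<open>vc \<le> card T < ivc\<close>.\<close>

lemma not_ivc_identical:
  fixes K :: "nat pair_pre_digraph"
  assumes H: "pair_graph H"
    and K: "pair_graph K" "\<not> embeds_induced H K"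
    and T: "vertex_cover K T" and I: "vertex_cover K I" "independent_set K I"
    and large: "\<And>J. vertex_cover K J \<Longrightarrow> independent_set K J \<Longrightarrow> card T < card J"
  shows "\<not> ivc_identical (free_bipartite_graphs H :: ('b :: infinite) pair_pre_digraph set)"
proof
  assume ident: "ivc_identical (free_bipartite_graphs H :: 'b pair_pre_digraph set)"
  interpret K: pair_graph K by fact
  obtain f :: "nat \<Rightarrow> 'b" where f: "inj f"
    using infinite_UNIV infinite_countable_subset by blast
  let ?G = "relabel f K"
  have pg: "pair_graph ?G" using K(1) f by (rule pair_graph_relabel)
  then interpret G: pair_graph ?G .
  note cover_G = vertex_cover_relabel[OF K.pair_wf_digraph G.pair_wf_digraph f]
  have "vertex_cover ?G (f ` I)" "independent_set ?G (f ` I)"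
    using I cover_G independent_set_relabel[OF f] by blast+
  then have bip: "bipartite ?G" using bipartite_iff_independent_vertex_cover by blast
  have "\<not> embeds_induced H ?G"
    using embeds_induced_relabel[OF _ K.pair_wf_digraph G.pair_wf_digraph f, of H] K(2) H
      pair_graph.axioms(1) pair_digraph.pair_wf_digraph by blast
  with ident pg bip have "ivc ?G = vc ?G"
    by (simp add: ivc_identical_def free_bipartite_graphs_def)
  moreover have "vc ?G \<le> card T"
  proof -
    have "vc ?G \<le> card (f ` T)" using T cover_G by (intro vc_le) blast
    also have "\<dots> = card T" using f by (intro card_image) (rule inj_on_subset, auto)
    finally show ?thesis .
  qed
  moreover have "card T < ivc ?G"
  proof -
    obtain J where J: "vertex_cover ?G J" "independent_set ?G J" "card J = ivc ?G"
      using bip by (rule ivc_attained)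
    then obtain J' where J': "J = f ` J'" "vertex_cover K J'" using cover_G by blast
    with J(2) have "card T < card J'" using large independent_set_relabel[OF f] by blast
    also have "card J' = ivc ?G"
      using J(3) J'(1) f card_image[of f J'] inj_on_subset by fastforce
    finally show ?thesis .
  qed
  ultimately show False by linarith
qed

section \<open>The double star and the long double star\<close>

definition double_star :: "nat pair_pre_digraph" where
  "double_star = \<lparr> pverts = {0, 1, 2, 3, 4, 5},
     parcs = {(0, 1), (1, 0), (0, 2), (2, 0), (0, 3), (3, 0), (1, 4), (4, 1), (1, 5), (5, 1)} \<rparr>"

text \<open>The centres \<open>0\<close> and \<open>3\<close> are joined by the path through
  \<open>1\<close> and \<open>2\<close>; their leaves are \<open>4\<close>, \<open>5\<close> and
  \<open>6\<close>, \<open>7\<close>.\<close>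

definition long_double_star :: "nat pair_pre_digraph" where
  "long_double_star = \<lparr> pverts = {0, 1, 2, 3, 4, 5, 6, 7},
     parcs = {(0, 1), (1, 0), (1, 2), (2, 1), (2, 3), (3, 2), (0, 4), (4, 0), (0, 5), (5, 0),
       (3, 6), (6, 3), (3, 7), (7, 3)} \<rparr>"

lemma double_star_simps [simp]:
  "pverts double_star = {0, 1, 2, 3, 4, 5}"
  "parcs double_star = {(0, 1), (1, 0), (0, 2), (2, 0), (0, 3), (3, 0), (1, 4), (4, 1), (1, 5), (5, 1)}"
  by (simp_all add: double_star_def)

lemma long_double_star_simps [simp]:
  "pverts long_double_star = {0, 1, 2, 3, 4, 5, 6, 7}"
  "parcs long_double_star = {(0, 1), (1, 0), (1, 2), (2, 1), (2, 3), (3, 2), (0, 4), (4, 0),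
     (0, 5), (5, 0), (3, 6), (6, 3), (3, 7), (7, 3)}"
  by (simp_all add: long_double_star_def)

lemma pair_graph_double_star: "pair_graph double_star"
  by unfold_locales (auto simp: symmetric_def sym_def)

lemma pair_graph_long_double_star: "pair_graph long_double_star"
  by unfold_locales (auto simp: symmetric_def sym_def)

lemma not_ivc_identical_double_star:
  assumes "pair_graph H" "\<not> embeds_induced H double_star"
  shows "\<not> ivc_identical (free_bipartite_graphs H :: ('b :: infinite) pair_pre_digraph set)"
proof (rule not_ivc_identical[OF assms(1) pair_graph_double_star assms(2)])
  have wf: "pair_wf_digraph double_star"
    using pair_graph_double_star pair_graph.axioms(1) pair_digraph.pair_wf_digraph by blast
  show "vertex_cover double_star {0, 1}" "vertex_cover double_star {0, 4, 5}"
    by (auto simp: vertex_cover_iff[OF wf])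
  show "independent_set double_star {0, 4, 5}"
    by (auto simp: independent_set_iff)
  fix J assume J: "vertex_cover double_star J" "independent_set double_star J"
  from J(1) have finite: "finite J"
    by (auto simp: vertex_cover_def intro: finite_subset)
  \<comment> \<open>Covering puts at least one end of an edge in \<open>J\<close>, independence at
    most one. As the tree is connected, \<open>J\<close> is one of its two sides.\<close>
  have alternating: "(u \<in> J) \<noteq> (v \<in> J)" if "(u, v) \<in> parcs double_star" for u v
    using J that unfolding vertex_cover_iff[OF wf] independent_set_iff by blast
  have "{0, 4, 5} \<subseteq> J \<or> {1, 2, 3} \<subseteq> J"
    using alternating[of 0 1] alternating[of 0 2] alternating[of 0 3] alternating[of 1 4] alternating[of 1 5] by auto
  with finite show "card {0, 1 :: nat} < card J"
    using card_mono[of J "{0, 4, 5}"] card_mono[of J "{1, 2, 3}"] by fastforce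
qed

lemma not_ivc_identical_long_double_star:
  assumes "pair_graph H" "\<not> embeds_induced H long_double_star"
  shows "\<not> ivc_identical (free_bipartite_graphs H :: ('b :: infinite) pair_pre_digraph set)"
proof (rule not_ivc_identical[OF assms(1) pair_graph_long_double_star assms(2)])
  have wf: "pair_wf_digraph long_double_star"
    using pair_graph_long_double_star pair_graph.axioms(1) pair_digraph.pair_wf_digraph by blast
  \<comment> \<open>The centres miss only the middle edge, which \<open>1\<close> covers. Each side
    has four vertices.\<close>
  show "vertex_cover long_double_star {0, 1, 3}" "vertex_cover long_double_star {0, 2, 6, 7}"
    by (auto simp: vertex_cover_iff[OF wf])
  show "independent_set long_double_star {0, 2, 6, 7}"
    by (auto simp: independent_set_iff)
  fix J assume J: "vertex_cover long_double_star J" "independent_set long_double_star J"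
  from J(1) have finite: "finite J"
    by (auto simp: vertex_cover_def intro: finite_subset)
  have alternating: "(u \<in> J) \<noteq> (v \<in> J)" if "(u, v) \<in> parcs long_double_star" for u v
    using J that unfolding vertex_cover_iff[OF wf] independent_set_iff by blast
  have "{0, 2, 6, 7} \<subseteq> J \<or> {1, 3, 4, 5} \<subseteq> J"
    using alternating[of 0 1] alternating[of 1 2] alternating[of 2 3] alternating[of 0 4] alternating[of 0 5] alternating[of 3 6] alternating[of 3 7] by auto
  with finite show "card {0, 1, 3 :: nat} < card J"
    using card_mono[of J "{0, 2, 6, 7}"] card_mono[of J "{1, 3, 4, 5}"] by fastforce
qed

lemma double_star_not_in_long_double_star: "\<not> embeds_induced double_star long_double_star"
proof
  assume "embeds_induced double_star long_double_star"
  then obtain f where f: "inj_on f (pverts double_star)"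
    "\<And>u v. u \<in> pverts double_star \<Longrightarrow> v \<in> pverts double_star \<Longrightarrow>
      (u, v) \<in> parcs double_star \<longleftrightarrow> (f u, f v) \<in> parcs long_double_star"
    by (rule embeds_inducedE) blast
  have centre: "x = 0 \<or> x = 3"
    if "(x, a) \<in> parcs long_double_star" "(x, b) \<in> parcs long_double_star"
      "(x, c) \<in> parcs long_double_star" "distinct [a, b, c]" for x a b c
  proof -
    have "x \<in> {0, 1, 2, 3, 4, 5, 6, 7}" using that(1) by auto
    then consider "x = 0" | "x = 3" | "x = 1" | "x = 2" | "x \<in> {4, 5, 6, 7}" by auto
    then show ?thesis
      by cases (use that in auto)
  qed
  have arc: "(f u, f v) \<in> parcs long_double_star" if "(u, v) \<in> parcs double_star" for u v
    by (rule f(2)[THEN iffD1, OF _ _ that]) (use that in auto)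
  have eq_iff: "f u = f v \<longleftrightarrow> u = v" if "u \<in> {0, 1, 2, 3, 4, 5}" "v \<in> {0, 1, 2, 3, 4, 5}" for u v
    using inj_on_eq_iff[OF f(1)] that by simp
  \<comment> \<open>The adjacent centres \<open>0\<close> and \<open>1\<close> keep three distinct
    neighbours, so their images are \<open>0\<close> and \<open>3\<close>, which are not
    adjacent.\<close>
  have "f 0 = 0 \<or> f 0 = 3"
    by (rule centre[OF arc[of 0 1] arc[of 0 2] arc[of 0 3]]) (simp_all add: eq_iff)
  moreover have "f 1 = 0 \<or> f 1 = 3"
    by (rule centre[OF arc[of 1 0] arc[of 1 4] arc[of 1 5]]) (simp_all add: eq_iff)
  moreover have "f 0 \<noteq> f 1" "(f 0, f 1) \<in> parcs long_double_star"
    by (simp add: eq_iff, rule arc, simp)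
  ultimately show False by auto
qed

section \<open>Induced subgraphs of the double star\<close>

text \<open>An embedding that is not onto misses a vertex: without a centre the double star is
  \<open>two_P1_P3\<close>, without a leaf it is \<open>claw_plus\<close>.\<close>

lemma embeds_induced_double_star_cases:
  assumes H: "pair_wf_digraph H" and "embeds_induced H double_star"
  obtains (whole) "embeds_induced double_star H" | (claw_plus) "embeds_induced H claw_plus"
    | (two_P1_P3) "embeds_induced H two_P1_P3"
proof -
  have K: "pair_wf_digraph double_star"
    using pair_graph_double_star pair_graph.axioms(1) pair_digraph.pair_wf_digraph by blast
  obtain f where f: "inj_on f (pverts H)" "f ` pverts H \<subseteq> pverts double_star"
    "\<And>u v. u \<in> pverts H \<Longrightarrow> v \<in> pverts H \<Longrightarrow> (u, v) \<in> parcs H \<longleftrightarrow> (f u, f v) \<in> parcs double_star"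
    using assms(2) by (rule embeds_inducedE) blast
  \<comment> \<open>Here \<open>g\<close> embeds the double star minus \<open>x\<close> into
    \<open>G\<close>; the vertex type of \<open>G\<close> is left open to serve both
    targets.\<close>
  have minus: "embeds_induced H G"
    if "pair_wf_digraph G" "x \<notin> f ` pverts H" "inj_on g ({0, 1, 2, 3, 4, 5} - {x})"
      "g ` ({0, 1, 2, 3, 4, 5} - {x}) \<subseteq> pverts G"
      "\<forall>u\<in>{0, 1, 2, 3, 4, 5} - {x}. \<forall>v\<in>{0, 1, 2, 3, 4, 5} - {x}.
        (u, v) \<in> parcs double_star \<longleftrightarrow> (g u, g v) \<in> parcs G"
    for G :: "'c pair_pre_digraph" and x g
  proof (rule embeds_inducedI[where f = "g \<circ> f"])
    have sub: "f ` pverts H \<subseteq> {0, 1, 2, 3, 4, 5} - {x}"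
      using f(2) that(2) by auto
    show "inj_on (g \<circ> f) (pverts H)"
      using f(1) sub that(3) by (meson comp_inj_on inj_on_subset)
    show "(g \<circ> f) ` pverts H \<subseteq> pverts G"
      using sub that(4) by (simp add: image_comp[symmetric] subset_eq)
    show "(u, v) \<in> parcs H \<longleftrightarrow> ((g \<circ> f) u, (g \<circ> f) v) \<in> parcs G"
      if "u \<in> pverts H" "v \<in> pverts H" for u v
    proof -
      from that sub have "f u \<in> {0, 1, 2, 3, 4, 5} - {x}" "f v \<in> {0, 1, 2, 3, 4, 5} - {x}"
        by blast+
      with \<open>\<forall>u\<in>_. \<forall>v\<in>_. _\<close> f(3)[OF that] show ?thesis by simp
    qed
  qed (use that H in auto)
  show thesis
  proof (cases "f ` pverts H = pverts double_star")
    case True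
    let ?g = "the_inv_into (pverts H) f"
    have "embeds_induced double_star H"
    proof (rule embeds_inducedI[where f = ?g, OF H K])
      show "inj_on ?g (pverts double_star)"
        using f(1) True by (metis inj_on_the_inv_into)
      show "?g ` pverts double_star \<subseteq> pverts H"
        using f(1) True by (metis subset_refl the_inv_into_onto)
      show "(u, v) \<in> parcs double_star \<longleftrightarrow> (?g u, ?g v) \<in> parcs H"
        if "u \<in> pverts double_star" "v \<in> pverts double_star" for u v
      proof -
        from that True obtain u' v' where "u = f u'" "v = f v'" "u' \<in> pverts H" "v' \<in> pverts H"
          by blast
        with f(3)[of u' v'] show ?thesis by (simp only: the_inv_into_f_f[OF f(1)])
      qed
    qed
    then show thesis by (rule whole)
  next
    case False
    with f(2) obtain x where x: "x \<in> {0, 1, 2, 3, 4, 5}" "x \<notin> f ` pverts H" by auto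
    note two = minus[OF pair_wf_digraph_two_P1_P3 x(2)] and claw = minus[OF pair_wf_digraph_claw_plus x(2)]
    from x(1) consider "x = 0" | "x = 1" | "x = 2" | "x = 3" | "x = 4" | "x = 5" by auto
    then show thesis
    proof cases
      case 1
      \<comment> \<open>Entry \<open>n\<close> of the list is the image of \<open>n\<close>; the
        entry at the missing vertex is a filler. The surviving centre is the middle of the
        path.\<close>
      have "embeds_induced H two_P1_P3"
        by (rule two[of "\<lambda>n. [Inr 0, Inr 1, Inl (0, 0), Inl (1, 0), Inr 0, Inr 2] ! n"])
          (simp_all add: 1 inj_on_def insert_Diff_if)
      then show thesis by (rule two_P1_P3)
    next
      case 2
      have "embeds_induced H two_P1_P3"
        by (rule two[of "\<lambda>n. [Inr 1, Inr 0, Inr 0, Inr 2, Inl (0, 0), Inl (1, 0)] ! n"])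
          (simp_all add: 2 inj_on_def insert_Diff_if)
      then show thesis by (rule two_P1_P3)
    next
      case 3
      \<comment> \<open>The centre that lost a leaf becomes the subdivision vertex \<open>4\<close>,
        its other leaf the end \<open>1\<close>.\<close>
      have "embeds_induced H claw_plus"
        by (rule claw[of "\<lambda>n. [4, 0, 0, 1, 2, 3] ! n"]) (simp_all add: 3 inj_on_def insert_Diff_if)
      then show thesis by (rule claw_plus)
    next
      case 4
      have "embeds_induced H claw_plus"
        by (rule claw[of "\<lambda>n. [4, 0, 1, 0, 2, 3] ! n"]) (simp_all add: 4 inj_on_def insert_Diff_if)
      then show thesis by (rule claw_plus)
    next
      case 5
      have "embeds_induced H claw_plus"
        by (rule claw[of "\<lambda>n. [0, 4, 2, 3, 0, 1] ! n"]) (simp_all add: 5 inj_on_def insert_Diff_if)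
      then show thesis by (rule claw_plus)
    next
      case 6
      have "embeds_induced H claw_plus"
        by (rule claw[of "\<lambda>n. [0, 4, 2, 3, 1, 0] ! n"]) (simp_all add: 6 inj_on_def insert_Diff_if)
      then show thesis by (rule claw_plus)
    qed
  qed
qed

theorem theorem2:
  fixes H :: "'a pair_pre_digraph"
  assumes "pair_graph H"
  shows "ivc_identical (free_bipartite_graphs H :: ('b :: infinite) pair_pre_digraph set) \<longleftrightarrow>
           embeds_induced H claw_plus \<or>
           embeds_induced H (disjoint_union (copies 2 (path_graph 1)) (path_graph 3))"
  unfolding two_P1_P3_def[symmetric]
proof
  interpret H: pair_graph H by fact
  assume ident: "ivc_identical (free_bipartite_graphs H :: 'b pair_pre_digraph set)"
  then have "embeds_induced H double_star" "embeds_induced H long_double_star"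
    using not_ivc_identical_double_star not_ivc_identical_long_double_star assms by blast+
  from H.pair_wf_digraph this(1) show "embeds_induced H claw_plus \<or> embeds_induced H two_P1_P3"
  proof (cases rule: embeds_induced_double_star_cases)
    \<comment> \<open>Then the double star would embed, through \<open>H\<close>, into the long
      double star.\<close>
    case whole
    have "pair_wf_digraph double_star" "pair_wf_digraph long_double_star"
      using pair_graph_double_star pair_graph_long_double_star
        pair_graph.axioms(1) pair_digraph.pair_wf_digraph by blast+
    then have "embeds_induced double_star long_double_star"
      using whole \<open>embeds_induced H long_double_star\<close> by (rule embeds_induced_trans)
    with double_star_not_in_long_double_star show ?thesis by blast
  qed auto
next
  interpret H: pair_graph H by fact
  assume H: "embeds_induced H claw_plus \<or> embeds_induced H two_P1_P3"
  show "ivc_identical (free_bipartite_graphs H :: 'b pair_pre_digraph set)"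
    unfolding ivc_identical_def
  proof
    fix G :: "'b pair_pre_digraph"
    assume "G \<in> free_bipartite_graphs H"
    then have G: "pair_graph G" "bipartite G" and free: "\<not> embeds_induced H G"
      by (auto simp: free_bipartite_graphs_def)
    then interpret G: pair_graph G by simp
    from G show "ivc G = vc G"
    proof (rule ivc_eq_vcI)
      \<comment> \<open>A small cover yields both target graphs inside \<open>G\<close>, hence
        \<open>H\<close> by transitivity, whichever of the two contains it.\<close>
      fix A B S assume "small_cover (parcs G) A B S" "A \<union> B \<subseteq> pverts G"
      then have "embeds_induced claw_plus G" "embeds_induced two_P1_P3 G"
        using small_cover.embeds_claw_plus small_cover.embeds_two_P1_P3 by blast+
      with H free show False
        using embeds_induced_trans[OF H.pair_wf_digraph G.pair_wf_digraph, of claw_plus]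
          embeds_induced_trans[OF H.pair_wf_digraph G.pair_wf_digraph, of two_P1_P3] by blast
    qed
  qed
qed

end
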